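(* There exists a generator $p_{g^*}(x|y,z)$ (the distribution of $G^*(y,z)$) whose induced conditional distributions $p_{g^*}(x|y)$ and $p_{g^*}(x|z)$ both achieve equilibrium in their own minimax games $\mathcal L_{xy}$ and $\mathcal L_{xz}$. That is: $p_{g^*}$ attains the global minimum over $p_g$ of $\max_{D_{xy}}\mathcal L_{xy}(D_{xy},p_g)$, and there is an inference conditional $p_{i^*}(z|x)$ such that $(p_{g^*},p_{i^*})$ attains the global minimum over $(p_g,p_i)$ of $\max_{D_{xz}}\mathcal L_{xz}(D_{xz},p_g,p_i)$.
   Context: Let $\mathcal X,\mathcal Y,\mathcal Z$ be standard Borel spaces (spaces of data $x$, structured codes $y$, unstructured codes $z$). Let $p(x,y)$ be a fixed probability distribution on $\mathcal X\times\mathcal Y$ (the true joint data distribution) with marginals $p(x)$ and $p(y)$, and let $p(z)$ be a fixed probability distribution (prior) on $\mathcal Z$; under the generative model $y$ and $z$ are independent, $y\sim p(y)$, $z\sim p(z)$. Nonparametric assumption: a generator is an arbitrary Markov kernel $p_g(x|y,z)$ from $\mathcal Y\times\mathcal Z$ to $\mathcal X$, an inference conditional is an arbitrary Markov kernel $p_i(z|x)$ from $\mathcal X$ to $\mathcal Z$, and discriminators are arbitrary measurable functions $D_{xz}:\mathcal X\times\mathcal Z\to[0,1]$ and $D_{xy}:\mathcal X\times\mathcal Y\to[0,1]$ (with $\log 0=-\infty$). The generator induces the conditionals $$p_g(x|z)=\int p(y)\,p_g(x|y,z)\,dy,\qquad p_g(x|y)=\int p(z)\,p_g(x|y,z)\,dz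 .$$ The objectives are $$\mathcal L_{xz}(D_{xz},p_g,p_i)=\mathbb E_{x\sim p(x),\,z\sim p_i(z|x)}[\log D_{xz}(x,z)]+\mathbb E_{y\sim p(y),\,z\sim p(z),\,x\sim p_g(x|y,z)}[\log(1-D_{xz}(x,z))],$$ $$\mathcal L_{xy}(D_{xy},p_g)=\mathbb E_{(x,y)\sim p(x,y)}[\log D_{xy}(x,y)]+\mathbb E_{y\sim p(y),\,z\sim p(z),\,x\sim p_g(x|y,z)}[\log(1-D_{xy}(x,y))].$$ The minimax games are $\min_{p_i,p_g}\max_{D_{xz}}\mathcal L_{xz}$ and $\min_{p_g}\max_{D_{xy}}\mathcal L_{xy}$. *)

theory Defs
  imports "HOL-Probability.Probability"
begin

text \<open>As usual in HOL-Probability, a value of type \<open>'a measure\<close> also serves as a measurable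
  space; its measure component is then irrelevant.\<close>

definition standard_borel :: "'a measure \<Rightarrow> bool" where
  "standard_borel M \<longleftrightarrow>
     (\<exists>T. topspace T = space M \<and> completely_metrizable_space T \<and> second_countable T \<and>
          sets M = sigma_sets (space M) {U. openin T U})"

abbreviation markov_kernels :: "'a measure \<Rightarrow> 'b measure \<Rightarrow> ('a \<Rightarrow> 'b measure) set" where
  "markov_kernels M N \<equiv> M \<rightarrow>\<^sub>M prob_algebra N"

abbreviation discriminators :: "'a measure \<Rightarrow> ('a \<Rightarrow> real) set" where
  "discriminators S \<equiv> S \<rightarrow>\<^sub>M restrict_space borel {0..1}"

definition marginal_x :: "'x measure \<Rightarrow> ('x \<times> 'y) measure \<Rightarrow> 'x measure" where
  "marginal_x X p = distr p X fst"

definition marginal_y :: "'y measure \<Rightarrow> ('x \<times> 'y) measure \<Rightarrow> 'y measure" where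
  "marginal_y Y p = distr p Y snd"

text \<open>The library has \<open>ln 0 = 0\<close>; here \<open>log 0 = -\<infinity>\<close> is needed. The function is only
  applied to arguments in \<open>[0,1]\<close>.\<close>

definition ext_log :: "real \<Rightarrow> ereal" where
  "ext_log r = (if r \<le> 0 then - \<infinity> else ereal (ln r))"

text \<open>Expectation of a \<open>[-\<infinity>,0]\<close>-valued function. The Bochner integral would return \<open>0\<close>
  on non-integrable functions, whereas this expectation is then \<open>-\<infinity>\<close>.\<close>

definition expectation_nonpos :: "'a measure \<Rightarrow> ('a \<Rightarrow> ereal) \<Rightarrow> ereal" where
  "expectation_nonpos M f = - enn2ereal (\<integral>\<^sup>+ a. e2ennreal (- f a) \<partial>M)"

text \<open>Laws of \<open>(x,z)\<close>: \<open>x \<sim> p(x), z \<sim> p\<^sub>i(z|x)\<close>, and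
  \<open>y \<sim> p(y), z \<sim> p(z), x \<sim> p\<^sub>g(x|y,z)\<close>.\<close>

definition inference_xz ::
    "'x measure \<Rightarrow> 'z measure \<Rightarrow> ('x \<times> 'y) measure \<Rightarrow> ('x \<Rightarrow> 'z measure) \<Rightarrow> ('x \<times> 'z) measure" where
  "inference_xz X Z p pinf =
     marginal_x X p \<bind> (\<lambda>x. pinf x \<bind> (\<lambda>z. return (X \<Otimes>\<^sub>M Z) (x, z)))"

definition generated_xz ::
    "'x measure \<Rightarrow> 'y measure \<Rightarrow> 'z measure \<Rightarrow> ('x \<times> 'y) measure \<Rightarrow> 'z measure \<Rightarrow>
     ('y \<times> 'z \<Rightarrow> 'x measure) \<Rightarrow> ('x \<times> 'z) measure" where
  "generated_xz X Y Z p pz pg =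
     marginal_y Y p \<bind> (\<lambda>y. pz \<bind> (\<lambda>z. pg (y, z) \<bind> (\<lambda>x. return (X \<Otimes>\<^sub>M Z) (x, z))))"

definition generated_xy ::
    "'x measure \<Rightarrow> 'y measure \<Rightarrow> ('x \<times> 'y) measure \<Rightarrow> 'z measure \<Rightarrow>
     ('y \<times> 'z \<Rightarrow> 'x measure) \<Rightarrow> ('x \<times> 'y) measure" where
  "generated_xy X Y p pz pg =
     marginal_y Y p \<bind> (\<lambda>y. pz \<bind> (\<lambda>z. pg (y, z) \<bind> (\<lambda>x. return (X \<Otimes>\<^sub>M Y) (x, y))))"

definition L_xz ::
    "'x measure \<Rightarrow> 'y measure \<Rightarrow> 'z measure \<Rightarrow> ('x \<times> 'y) measure \<Rightarrow> 'z measure \<Rightarrow>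
     ('x \<times> 'z \<Rightarrow> real) \<Rightarrow> ('y \<times> 'z \<Rightarrow> 'x measure) \<Rightarrow> ('x \<Rightarrow> 'z measure) \<Rightarrow> ereal" where
  "L_xz X Y Z p pz D pg pinf =
     expectation_nonpos (inference_xz X Z p pinf) (\<lambda>w. ext_log (D w)) +
     expectation_nonpos (generated_xz X Y Z p pz pg) (\<lambda>w. ext_log (1 - D w))"

definition L_xy ::
    "'x measure \<Rightarrow> 'y measure \<Rightarrow> ('x \<times> 'y) measure \<Rightarrow> 'z measure \<Rightarrow>
     ('x \<times> 'y \<Rightarrow> real) \<Rightarrow> ('y \<times> 'z \<Rightarrow> 'x measure) \<Rightarrow> ereal" where
  "L_xy X Y p pz D pg =
     expectation_nonpos p (\<lambda>w. ext_log (D w)) +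
     expectation_nonpos (generated_xy X Y p pz pg) (\<lambda>w. ext_log (1 - D w))"

definition sup_L_xz ::
    "'x measure \<Rightarrow> 'y measure \<Rightarrow> 'z measure \<Rightarrow> ('x \<times> 'y) measure \<Rightarrow> 'z measure \<Rightarrow>
     ('y \<times> 'z \<Rightarrow> 'x measure) \<Rightarrow> ('x \<Rightarrow> 'z measure) \<Rightarrow> ereal" where
  "sup_L_xz X Y Z p pz pg pinf = (SUP D\<in>discriminators (X \<Otimes>\<^sub>M Z). L_xz X Y Z p pz D pg pinf)"

definition sup_L_xy ::
    "'x measure \<Rightarrow> 'y measure \<Rightarrow> ('x \<times> 'y) measure \<Rightarrow> 'z measure \<Rightarrow>
     ('y \<times> 'z \<Rightarrow> 'x measure) \<Rightarrow> ereal" where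
  "sup_L_xy X Y p pz pg = (SUP D\<in>discriminators (X \<Otimes>\<^sub>M Y). L_xy X Y p pz D pg)"

definition induced_given_z ::
    "'y measure \<Rightarrow> ('x \<times> 'y) measure \<Rightarrow> ('y \<times> 'z \<Rightarrow> 'x measure) \<Rightarrow> 'z \<Rightarrow> 'x measure" where
  "induced_given_z Y p pg z = marginal_y Y p \<bind> (\<lambda>y. pg (y, z))"

definition induced_given_y ::
    "'z measure \<Rightarrow> ('y \<times> 'z \<Rightarrow> 'x measure) \<Rightarrow> 'y \<Rightarrow> 'x measure" where
  "induced_given_y pz pg y = pz \<bind> (\<lambda>z. pg (y, z))"

text \<open>The two games depend on the generator only through its induced conditionals.\<close>

lemma marginal_y_in_prob_algebra:
  assumes "p \<in> space (prob_algebra (X \<Otimes>\<^sub>M Y))"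
  shows "marginal_y Y p \<in> space (prob_algebra Y)"
proof -
  have "sets p = sets (X \<Otimes>\<^sub>M Y)" "prob_space p"
    using assms by (auto simp: space_prob_algebra)
  then have "snd \<in> p \<rightarrow>\<^sub>M Y"
    by (simp cong: measurable_cong_sets)
  with \<open>prob_space p\<close> show ?thesis
    by (simp add: marginal_y_def space_prob_algebra prob_space.prob_space_distr)
qed

lemma generated_xy_eq_induced:
  assumes p: "p \<in> space (prob_algebra (X \<Otimes>\<^sub>M Y))"
    and pz: "pz \<in> space (prob_algebra Z)"
    and pg: "pg \<in> markov_kernels (Y \<Otimes>\<^sub>M Z) X"
  shows "generated_xy X Y p pz pg =
    marginal_y Y p \<bind> (\<lambda>y. induced_given_y pz pg y \<bind> (\<lambda>x. return (X \<Otimes>\<^sub>M Y) (x, y)))"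
proof -
  have [measurable]: "pg \<in> (Y \<Otimes>\<^sub>M Z) \<rightarrow>\<^sub>M subprob_algebra X"
    using pg by (rule measurable_prob_algebraD)
  have sz [measurable_cong]: "sets pz = sets Z" using pz by (simp add: space_prob_algebra)
  have sy: "space (marginal_y Y p) = space Y" by (simp add: marginal_y_def)
  show ?thesis
    unfolding generated_xy_def induced_given_y_def
  proof (rule bind_cong[OF refl])
    fix y assume "y \<in> space (marginal_y Y p)"
    then have [measurable]: "y \<in> space Y" by (simp add: sy)
    show "pz \<bind> (\<lambda>z. pg (y, z) \<bind> (\<lambda>x. return (X \<Otimes>\<^sub>M Y) (x, y))) =
          pz \<bind> (\<lambda>z. pg (y, z)) \<bind> (\<lambda>x. return (X \<Otimes>\<^sub>M Y) (x, y))"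
      by (rule bind_assoc[symmetric, where N = X and R = "X \<Otimes>\<^sub>M Y"]) measurable
  qed
qed

lemma generated_xz_eq_induced:
  assumes p: "p \<in> space (prob_algebra (X \<Otimes>\<^sub>M Y))"
    and pz: "pz \<in> space (prob_algebra Z)"
    and pg: "pg \<in> markov_kernels (Y \<Otimes>\<^sub>M Z) X"
  shows "generated_xz X Y Z p pz pg =
    pz \<bind> (\<lambda>z. induced_given_z Y p pg z \<bind> (\<lambda>x. return (X \<Otimes>\<^sub>M Z) (x, z)))"
proof -
  let ?py = "marginal_y Y p"
  have [measurable]: "pg \<in> (Y \<Otimes>\<^sub>M Z) \<rightarrow>\<^sub>M subprob_algebra X"
    using pg by (rule measurable_prob_algebraD)
  have sz [measurable_cong]: "sets pz = sets Z" and "prob_space pz"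
    using pz by (simp_all add: space_prob_algebra)
  have sy [measurable_cong]: "sets ?py = sets Y" and "prob_space ?py"
    using marginal_y_in_prob_algebra[OF p] by (simp_all add: space_prob_algebra)
  interpret py: prob_space ?py by fact
  interpret pz: prob_space pz by fact
  interpret pair_prob_space ?py pz ..
  have "generated_xz X Y Z p pz pg =
      pz \<bind> (\<lambda>z. ?py \<bind> (\<lambda>y. pg (y, z) \<bind> (\<lambda>x. return (X \<Otimes>\<^sub>M Z) (x, z))))"
    unfolding generated_xz_def by (rule bind_rotate[where N = "X \<Otimes>\<^sub>M Z"]) measurable
  also have "\<dots> = pz \<bind> (\<lambda>z. induced_given_z Y p pg z \<bind> (\<lambda>x. return (X \<Otimes>\<^sub>M Z) (x, z)))"
    unfolding induced_given_z_def
  proof (rule bind_cong[OF refl])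
    fix z assume "z \<in> space pz"
    then have [measurable]: "z \<in> space Z" using sets_eq_imp_space_eq[OF sz] by simp
    show "?py \<bind> (\<lambda>y. pg (y, z) \<bind> (\<lambda>x. return (X \<Otimes>\<^sub>M Z) (x, z))) =
          ?py \<bind> (\<lambda>y. pg (y, z)) \<bind> (\<lambda>x. return (X \<Otimes>\<^sub>M Z) (x, z))"
      by (rule bind_assoc[symmetric, where N = X and R = "X \<Otimes>\<^sub>M Z"]) measurable
  qed
  finally show ?thesis .
qed

end

theory Submission
  imports Defs
begin

text \<open>Take \<open>p\<^sub>g(x|y,z) = p(x|y)\<close>, the regular conditional distribution of the data, and let
  \<open>p\<^sub>i(z|x)\<close> be the prior. Then the generated law of \<open>(x,y)\<close> is \<open>p\<close>, and both laws of \<open>(x,z)\<close>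
  are \<open>p(x) \<otimes> p(z)\<close>. When its two laws coincide, the value of a discriminator game is at most
  \<open>-2 ln 2\<close> because \<open>D (1 - D) \<le> 1/4\<close>, with equality at \<open>D = 1/2\<close>; and \<open>D = 1/2\<close> yields
  \<open>-2 ln 2\<close> whatever the two laws are.

  The regular conditional distribution is built from conditional distribution functions when \<open>x\<close>
  is real, and a standard Borel space is a measurable retract of the reals.\<close>

section \<open>Conditional distributions of a real random variable\<close>

text \<open>On the set \<open>N\<close> where the inequality fails, \<open>v\<close> lies below
  \<open>u\<close> and so has a finite integral. The difference of the two integrals over
  \<open>N\<close> can therefore be formed; it is zero by assumption, which forces \<open>N\<close>
  to be null. This compares Radon-Nikodym derivatives, known only through their integrals over
  sets.\<close>

lemma AE_le_if_set_nn_integral_le: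
  fixes u v :: "'a \<Rightarrow> ennreal"
  assumes [measurable]: "u \<in> borel_measurable M" "v \<in> borel_measurable M"
    and fin: "(\<integral>\<^sup>+ x. u x \<partial>M) < \<infinity>"
    and le: "\<And>A. A \<in> sets M \<Longrightarrow> (\<integral>\<^sup>+ x\<in>A. u x \<partial>M) \<le> (\<integral>\<^sup>+ x\<in>A. v x \<partial>M)"
  shows "AE x in M. u x \<le> v x"
proof -
  define N where "N = {x \<in> space M. v x < u x}"
  have [measurable]: "N \<in> sets M" unfolding N_def by measurable
  have "(\<integral>\<^sup>+ x\<in>N. v x \<partial>M) \<le> (\<integral>\<^sup>+ x. u x \<partial>M)"
    by (rule nn_integral_mono) (auto simp: N_def indicator_def)
  then have "(\<integral>\<^sup>+ x\<in>N. v x \<partial>M) \<noteq> \<infinity>"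
    using fin by (auto simp: top_unique)
  then have "(\<integral>\<^sup>+ x. u x * indicator N x - v x * indicator N x \<partial>M) =
      (\<integral>\<^sup>+ x\<in>N. u x \<partial>M) - (\<integral>\<^sup>+ x\<in>N. v x \<partial>M)"
    by (intro nn_integral_diff) (auto simp: N_def indicator_def)
  also have "\<dots> = 0"
  proof -
    have "(\<integral>\<^sup>+ x\<in>N. u x \<partial>M) \<le> (\<integral>\<^sup>+ x. u x \<partial>M)"
      by (rule nn_integral_mono) (auto simp: indicator_def)
    then show ?thesis
      using le[of N] fin by (simp add: diff_eq_0_iff_ennreal)
  qed
  finally have "AE x in M. u x * indicator N x - v x * indicator N x = 0"
    by (subst (asm) nn_integral_0_iff_AE) auto
  then show ?thesis
  proof (rule AE_mp, intro AE_I2 impI)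
    fix x assume x: "x \<in> space M" and eq: "u x * indicator N x - v x * indicator N x = 0"
    show "u x \<le> v x"
    proof (rule ccontr)
      assume "\<not> u x \<le> v x"
      then have "x \<in> N" using x by (auto simp: N_def)
      then show False using eq \<open>\<not> u x \<le> v x\<close> by (simp add: diff_eq_0_iff_ennreal)
    qed
  qed
qed

text \<open>Reaches values of right-continuous functions from rational arguments. The inequality is
  strict because the infimum in \<open>rational_cdf_kernel\<close> runs over rationals strictly
  above \<open>t\<close>.\<close>

lemma ex_rat_sequence_at_right:
  fixes t :: real
  obtains q :: "nat \<Rightarrow> rat" where "\<And>n. t < of_rat (q n)" "(\<lambda>n. of_rat (q n) :: real) \<longlonglongrightarrow> t"
proof -
  have "\<exists>q. t < of_rat q \<and> of_rat q < t + inverse (real (Suc n))" for n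
    by (rule of_rat_dense) simp
  then obtain q where q: "\<And>n. t < of_rat (q n)" "\<And>n. of_rat (q n) < t + inverse (real (Suc n))"
    by metis
  have "(\<lambda>n. of_rat (q n) :: real) \<longlonglongrightarrow> t"
  proof (rule tendsto_sandwich[of "\<lambda>_. t"])
    show "(\<lambda>n. t + inverse (real (Suc n))) \<longlonglongrightarrow> t"
      using tendsto_add[OF tendsto_const LIMSEQ_inverse_real_of_nat, of t] by simp
  qed (use q in \<open>auto intro!: always_eventually less_imp_le simp del: of_nat_Suc\<close>)
  with q show ?thesis using that by blast
qed

lemma sets_borel_eq_sigma_sets_atMost:
  "sets (borel :: real measure) = sigma_sets UNIV (range atMost)"
  unfolding borel_eq_atMost by (rule sets_measure_of) simp

text \<open>The kernel has distribution functions \<open>t \<mapsto> INF q > t. F q y\<close>.\<close>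

lemma rational_cdf_kernel:
  fixes F :: "rat \<Rightarrow> 'y \<Rightarrow> real"
  assumes [measurable]: "\<And>q. F q \<in> borel_measurable Y"
    and mono: "\<And>q r y. y \<in> space Y \<Longrightarrow> q \<le> r \<Longrightarrow> F q y \<le> F r y"
    and low: "\<And>q y. y \<in> space Y \<Longrightarrow> q < 0 \<Longrightarrow> F q y = 0"
    and high: "\<And>q y. y \<in> space Y \<Longrightarrow> 1 \<le> q \<Longrightarrow> F q y = 1"
  shows "\<exists>\<kappa> \<in> Y \<rightarrow>\<^sub>M prob_algebra borel. \<forall>y\<in>space Y. \<forall>(t :: real) q.
    (\<forall>n. t < of_rat (q n)) \<longrightarrow> (\<lambda>n. of_rat (q n)) \<longlonglongrightarrow> t \<longrightarrow>
    (\<lambda>n. F (q n) y) \<longlonglongrightarrow> measure (\<kappa> y) {..t}"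
proof -
  have nonneg: "0 \<le> F q y" if "y \<in> space Y" for q y
    \<comment> \<open>The comparison point is negative and at most \<open>q\<close>, so
      \<open>F\<close> vanishes there.\<close>
    using mono[OF that, of "min q (-1)" q] low[OF that, of "min q (-1)"] by simp
  have le1: "F q y \<le> 1" if "y \<in> space Y" for q y
    using mono[OF that, of q "max q 1"] high[OF that, of "max q 1"] by simp
  define H where "H y t = (INF q\<in>{q. t < of_rat q}. F q y)" for y and t :: real
  have ne: "{q. t < of_rat q} \<noteq> {}" for t :: real
    using ex_rat_sequence_at_right[of t] by blast
  have bdd: "bdd_below ((\<lambda>q. F q y) ` S)" if "y \<in> space Y" for y S
    using nonneg[OF that] by (auto intro!: bdd_belowI[of _ 0])
  have H_le: "H y t \<le> F q y" if "y \<in> space Y" "t < of_rat q" for y t q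
    unfolding H_def using that by (intro cINF_lower bdd) auto
  have H_ge: "c \<le> H y t" if "\<And>q. t < of_rat q \<Longrightarrow> c \<le> F q y" for y t c
    unfolding H_def using that ne by (intro cINF_greatest) auto
  have H_mono: "H y s \<le> H y t" if "y \<in> space Y" "s \<le> t" for y s t
    using that by (intro H_ge H_le) auto
  have H_approx: "\<exists>q. t < of_rat q \<and> F q y < H y t + e" if "y \<in> space Y" "0 < e" for y t e
  proof (rule ccontr)
    assume "\<not> ?thesis"
    then have "F q y \<ge> H y t + e" if "t < of_rat q" for q
      using that by force
    then have "H y t + e \<le> H y t" by (rule H_ge)
    with that show False by simp
  qed
  \<comment> \<open>Monotonicity bounds \<open>H y\<close> from below to the right of
    \<open>t\<close>. From above, a rational \<open>q > t\<close> with \<open>F q y\<close> close to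
    the infimum bounds \<open>H y\<close> on the whole interval between \<open>t\<close> and
    \<open>q\<close>.\<close>
  have H_right: "continuous (at_right t) (H y)" if y: "y \<in> space Y" for y t
    unfolding continuous_within
  proof (rule order_tendstoI)
    fix a assume "a < H y t"
    then show "eventually (\<lambda>s. a < H y s) (at_right t)"
      using H_mono[OF y] by (auto simp: eventually_at_filter intro!: always_eventually
          intro: less_le_trans)
  next
    fix a assume "H y t < a"
    then obtain q where q: "t < of_rat q" "F q y < a"
      using H_approx[OF y, of "a - H y t" t] by auto
    then show "eventually (\<lambda>s. H y s < a) (at_right t)"
      using H_le[OF y] by (auto simp: eventually_at_right intro!: exI[of _ "of_rat q"]
          intro: le_less_trans)
  qed
  have H_low: "H y t = 0" if "y \<in> space Y" "t < 0" for y t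
  proof -
    obtain q where "t < of_rat q" "of_rat q < (0::real)"
      using of_rat_dense[OF \<open>t < 0\<close>] by blast
    then have "H y t \<le> 0" using H_le[OF that(1), of t q] low[OF that(1), of q] by simp
    moreover have "0 \<le> H y t" using nonneg[OF that(1)] by (intro H_ge)
    ultimately show ?thesis by simp
  qed
  have H_high: "H y t = 1" if "y \<in> space Y" "1 \<le> t" for y t
  proof -
    have hq: "F q y = 1" if "t < of_rat q" for q
    proof -
      have "(1::real) < of_rat q" using \<open>1 \<le> t\<close> that by linarith
      then show ?thesis using high[OF \<open>y \<in> space Y\<close>, of q] by simp
    qed
    then have "H y t = (INF q\<in>{q. t < of_rat q}. 1)" unfolding H_def by (intro INF_cong) auto
    then show ?thesis using ne[of t] by simp
  qed
  have H_bot: "(H y \<longlongrightarrow> 0) at_bot" if "y \<in> space Y" for y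
    by (rule tendsto_eventually)
       (auto simp: eventually_at_bot_dense intro!: exI[of _ 0] H_low that)
  have H_top: "(H y \<longlongrightarrow> 1) at_top" if "y \<in> space Y" for y
    by (rule tendsto_eventually)
       (auto simp: eventually_at_top_linorder intro!: exI[of _ 1] H_high that)
  have H_meas: "(\<lambda>y. H y t) \<in> borel_measurable Y" for t
    unfolding H_def by (rule borel_measurable_cINF) (auto intro: bdd)
  \<comment> \<open>The Lebesgue-Stieltjes measure of \<open>H y\<close>, a probability measure by
    \<open>H_bot\<close> and \<open>H_top\<close>.\<close>
  define \<kappa> where "\<kappa> y = interval_measure (H y)" for y
  have dist: "real_distribution (\<kappa> y)" if "y \<in> space Y" for y
    unfolding \<kappa>_def
    by (intro real_distribution_interval_measure H_mono H_right H_bot H_top that)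
  have cdf: "measure (\<kappa> y) {..t} = H y t" if "y \<in> space Y" for y t
    using cdf_interval_measure[of "H y"] H_mono[OF that] H_right[OF that] H_bot[OF that]
    by (simp add: \<kappa>_def cdf_def fun_eq_iff)
  show ?thesis
  proof (intro bexI[of _ \<kappa>] ballI allI impI)
    show "\<kappa> \<in> Y \<rightarrow>\<^sub>M prob_algebra borel"
    proof (rule measurable_prob_algebra_generated[where \<Omega> = UNIV and G = "range atMost"])
      show "sets (borel :: real measure) = sigma_sets UNIV (range atMost)"
        by (rule sets_borel_eq_sigma_sets_atMost)
      show "Int_stable (range (atMost :: real \<Rightarrow> real set))"
        by (auto simp: Int_stable_def)
      fix A assume "A \<in> range (atMost :: real \<Rightarrow> real set)"
      then obtain t where A: "A = {..t}" by auto
      have "emeasure (\<kappa> y) A = ennreal (H y t)" if "y \<in> space Y" for y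
      proof -
        interpret real_distribution "\<kappa> y" by (rule dist[OF that])
        show ?thesis by (simp add: emeasure_eq_measure A cdf[OF that])
      qed
      then show "(\<lambda>y. emeasure (\<kappa> y) A) \<in> borel_measurable Y"
        using H_meas[of t] by (simp cong: measurable_cong)
    next
      show "prob_space (\<kappa> y)" if "y \<in> space Y" for y
        using dist[OF that] by (simp add: real_distribution_def)
    qed (simp_all add: \<kappa>_def)
  next
    fix y and t :: real and q :: "nat \<Rightarrow> rat"
    assume y: "y \<in> space Y" and q1: "\<forall>n. t < of_rat (q n)" and q2: "(\<lambda>n. of_rat (q n)) \<longlonglongrightarrow> t"
    note q = q1[rule_format] q2
    have "filterlim (\<lambda>n. of_rat (q n)) (at_right t) sequentially"
      using q by (auto simp: filterlim_at intro!: always_eventually less_imp_neq[symmetric])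
    then have "(\<lambda>n. H y (of_rat (q n))) \<longlonglongrightarrow> H y t"
      using H_right[OF y, of t] unfolding continuous_within by (rule filterlim_compose[rotated])
    \<comment> \<open>All rationals above \<open>q n\<close> have \<open>F\<close>-values at least
      \<open>F (q n) y\<close>. Hence this number lies between \<open>H y t\<close> and the value of
      \<open>H y\<close> at \<open>q n\<close>, which tends to \<open>H y t\<close>.\<close>
    moreover have "F (q n) y \<le> H y (of_rat (q n))" for n
      using mono[OF y] by (intro H_ge) (simp add: of_rat_less)
    moreover have "H y t \<le> F (q n) y" for n
      using y q(1) by (rule H_le)
    ultimately have "(\<lambda>n. F (q n) y) \<longlonglongrightarrow> H y t"
      by (rule_tac tendsto_sandwich[OF _ _ tendsto_const]) (simp_all add: always_eventually)
    then show "(\<lambda>n. F (q n) y) \<longlonglongrightarrow> measure (\<kappa> y) {..t}"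
      by (simp add: cdf[OF y])
  qed
qed

text \<open>For each \<open>t\<close> a Radon-Nikodym derivative serves as the conditional
  probability of \<open>f x \<le> t\<close> given \<open>h\<close>. At rational \<open>t\<close>
  these are corrected on a null set and turned into a kernel. The range \<open>{0..1}\<close> fixes
  the values 0 left of 0 and 1 from 1 on, so limits at infinity need no separate argument.\<close>

lemma (in prob_space) real_disintegration:
  fixes f :: "'a \<Rightarrow> real" and Y :: "'c measure"
  assumes f [measurable]: "f \<in> borel_measurable M" and h [measurable]: "h \<in> M \<rightarrow>\<^sub>M Y"
    and range_f: "\<And>x. x \<in> space M \<Longrightarrow> f x \<in> {0..1}"
  shows "\<exists>\<kappa> \<in> Y \<rightarrow>\<^sub>M prob_algebra borel. \<forall>A\<in>sets borel. \<forall>B\<in>sets Y.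
    (\<integral>\<^sup>+ y\<in>B. emeasure (\<kappa> y) A \<partial>distr M Y h) = emeasure M {x \<in> space M. f x \<in> A \<and> h x \<in> B}"
proof -
  define \<eta> where "\<eta> = distr M Y h"
  interpret \<eta>: prob_space \<eta> unfolding \<eta>_def by (rule prob_space_distr) fact
  have sets_\<eta> [measurable_cong]: "sets \<eta> = sets Y" by (simp add: \<eta>_def)
  have space_\<eta>: "space \<eta> = space Y" by (simp add: \<eta>_def)
  define J where "J t B = emeasure M {x \<in> space M. f x \<le> t \<and> h x \<in> B}" for t B
  have J_mono: "J s B \<le> J t B" if [measurable]: "B \<in> sets Y" and "s \<le> t" for s t B
    unfolding J_def using that(2) by (intro emeasure_mono) auto
  have J_le: "J t B \<le> emeasure \<eta> B" if [measurable]: "B \<in> sets Y" for t B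
    unfolding J_def \<eta>_def by (subst emeasure_distr) (auto intro!: emeasure_mono)
  have "\<exists>g \<in> borel_measurable Y. \<forall>B \<in> sets Y. (\<integral>\<^sup>+ y\<in>B. g y \<partial>\<eta>) = J t B" for t
  proof -
    \<comment> \<open>Realises \<open>J t\<close> as a measure: the image under \<open>h\<close> of
      \<open>M\<close> restricted to an event. It is at most \<open>\<eta>\<close>, hence absolutely
      continuous.\<close>
    define \<nu> where "\<nu> = distr (density M (indicator {x \<in> space M. f x \<le> t})) Y h"
    have em: "emeasure \<nu> B = J t B" if [measurable]: "B \<in> sets Y" for B
    proof -
      have "emeasure \<nu> B = (\<integral>\<^sup>+ x. indicator {x \<in> space M. f x \<le> t} x * indicator (h -` B \<inter> space M) x \<partial>M)"
        by (simp add: \<nu>_def emeasure_distr emeasure_density)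
      also have "\<dots> = (\<integral>\<^sup>+ x. indicator {x \<in> space M. f x \<le> t \<and> h x \<in> B} x \<partial>M)"
        by (rule nn_integral_cong) (auto simp: indicator_def)
      finally show ?thesis by (simp add: J_def)
    qed
    have "absolutely_continuous \<eta> \<nu>"
      unfolding absolutely_continuous_def
    proof
      fix B assume "B \<in> null_sets \<eta>"
      then have "B \<in> sets Y" "emeasure \<eta> B = 0" by (auto simp: sets_\<eta>)
      then show "B \<in> null_sets \<nu>"
        using em[of B] J_le[of B t] by (auto simp: \<nu>_def)
    qed
    moreover have "sets \<nu> = sets \<eta>" by (simp add: \<nu>_def \<eta>_def)
    ultimately obtain g where g: "g \<in> borel_measurable \<eta>" "density \<eta> g = \<nu>"
      using \<eta>.Radon_Nikodym by blast
    then have "(\<integral>\<^sup>+ y\<in>B. g y \<partial>\<eta>) = J t B" if "B \<in> sets Y" for B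
      using em[OF that] that by (subst emeasure_density[symmetric]) (auto simp: sets_\<eta>)
    then show ?thesis using g by (auto intro!: bexI[of _ g])
  qed
  then obtain g where g [measurable]: "\<And>t. g t \<in> borel_measurable Y"
    and int_g: "\<And>t B. B \<in> sets Y \<Longrightarrow> (\<integral>\<^sup>+ y\<in>B. g t y \<partial>\<eta>) = J t B"
    by metis
  have fin_g: "(\<integral>\<^sup>+ y. g t y \<partial>\<eta>) < \<infinity>" for t
  proof -
    have "(\<integral>\<^sup>+ y. g t y \<partial>\<eta>) = (\<integral>\<^sup>+ y\<in>space Y. g t y \<partial>\<eta>)"
      by (rule nn_integral_cong) (simp add: space_\<eta>)
    also have "\<dots> < \<infinity>"
      by (subst int_g) (auto simp: J_def less_top[symmetric])
    finally show ?thesis .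
  qed
  have g_mono: "AE y in \<eta>. g s y \<le> g t y" if "s \<le> t" for s t
    by (rule AE_le_if_set_nn_integral_le)
       (use that in \<open>auto simp: int_g sets_\<eta> fin_g[simplified] intro: J_mono\<close>)
  have g_low: "AE y in \<eta>. g t y \<le> 0" if "t < 0" for t
  proof (rule AE_le_if_set_nn_integral_le)
    fix B assume "B \<in> sets \<eta>"
    moreover have "{x \<in> space M. f x \<le> t \<and> h x \<in> B} = {}"
      using range_f that by fastforce
    then have "J t B = 0" unfolding J_def by (simp only: emeasure_empty)
    ultimately show "(\<integral>\<^sup>+ y\<in>B. g t y \<partial>\<eta>) \<le> (\<integral>\<^sup>+ y\<in>B. 0 \<partial>\<eta>)"
      by (simp add: int_g sets_\<eta>)
  qed (use fin_g in auto)
  have J_high: "J t B = emeasure \<eta> B" if "1 \<le> t" "B \<in> sets Y" for t B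
  proof -
    have "{x \<in> space M. f x \<le> t \<and> h x \<in> B} = h -` B \<inter> space M"
      using range_f that by fastforce
    then show ?thesis
      using that by (simp add: J_def \<eta>_def emeasure_distr)
  qed
  have g_high1: "AE y in \<eta>. 1 \<le> g t y" if "1 \<le> t" for t
    by (rule AE_le_if_set_nn_integral_le)
       (use that in \<open>auto simp: int_g sets_\<eta> J_high \<eta>.emeasure_space_1\<close>)
  have g_high2: "AE y in \<eta>. g t y \<le> 1" if "1 \<le> t" for t
    by (rule AE_le_if_set_nn_integral_le)
       (use that fin_g in \<open>auto simp: int_g sets_\<eta> J_high\<close>)
  \<comment> \<open>The conditional probabilities \<open>g t\<close> are only determined almost everywhere; on \<open>G\<close> they form
    a distribution function over the rationals, and elsewhere a point mass is used instead.\<close>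
  define G where "G = {y \<in> space Y. (\<forall>q r :: rat. q \<le> r \<longrightarrow> g (of_rat q) y \<le> g (of_rat r) y) \<and>
      (\<forall>q :: rat. q < 0 \<longrightarrow> g (of_rat q) y \<le> 0) \<and>
      (\<forall>q :: rat. 1 \<le> q \<longrightarrow> 1 \<le> g (of_rat q) y \<and> g (of_rat q) y \<le> 1)}"
  have G [measurable]: "G \<in> sets Y" unfolding G_def by measurable
  \<comment> \<open>Restricting \<open>t\<close> to rationals leaves countably many almost sure
    conditions, so their conjunction still holds almost surely.\<close>
  have AE_G: "AE y in \<eta>. y \<in> G"
  proof -
    have "AE y in \<eta>. \<forall>q r :: rat. q \<le> r \<longrightarrow> g (of_rat q) y \<le> g (of_rat r) y"
      by (auto simp: AE_all_countable of_rat_less_eq intro!: g_mono)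
    moreover have "AE y in \<eta>. \<forall>q :: rat. q < 0 \<longrightarrow> g (of_rat q) y \<le> 0"
      using g_low by (auto simp: AE_all_countable simp del: le_zero_eq)
    moreover have "AE y in \<eta>. \<forall>q :: rat. 1 \<le> q \<longrightarrow> 1 \<le> g (of_rat q) y \<and> g (of_rat q) y \<le> 1"
      using g_high1 g_high2 by (auto simp: AE_all_countable)
    ultimately show ?thesis
      using AE_space[of \<eta>] by eventually_elim (auto simp: G_def space_\<eta>)
  qed
  have G_mono: "g (of_rat q) y \<le> g (of_rat r) y" if "y \<in> G" "q \<le> r" for q r :: rat and y
    using that unfolding G_def by blast
  have G_low: "g (of_rat q) y = 0" if "y \<in> G" "q < 0" for q :: rat and y
    using that unfolding G_def by auto
  have G_high: "g (of_rat q) y = 1" if "y \<in> G" "1 \<le> q" for q :: rat and y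
    using that unfolding G_def by (blast intro: antisym)
  define F where "F q y = (if y \<in> G then enn2real (g (of_rat q) y) else if q < 0 then 0 else 1)"
    for q y
  have F_meas [measurable]: "F q \<in> borel_measurable Y" for q
    unfolding F_def by measurable
  have g_le1: "g (of_rat q) y \<le> 1" if "y \<in> G" for q y
  proof -
    have "g (of_rat q) y \<le> g (of_rat (max q 1)) y"
      by (rule G_mono[OF that]) simp
    also have "\<dots> = 1" by (rule G_high[OF that]) simp
    finally show ?thesis .
  qed
  have ennreal_F: "ennreal (F q y) = g (of_rat q) y" if "y \<in> G" for q y
    using g_le1[OF that, of q] that le_less_trans[OF _ ennreal_one_less_top]
    by (simp add: F_def ennreal_enn2real)
  have F_range: "0 \<le> F q y" "F q y \<le> 1" for q y
    using g_le1[of y q] by (auto simp: F_def enn2real_leI)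
  have F_mono: "F q y \<le> F r y" if "q \<le> r" for q r y
  proof (cases "y \<in> G")
    case True
    then have "ennreal (F q y) \<le> ennreal (F r y)"
      using that by (simp add: ennreal_F G_mono)
    then show ?thesis using F_range by simp
  qed (use that in \<open>auto simp: F_def\<close>)
  have F_low: "F q y = 0" if "q < 0" for q y
    using that by (simp add: F_def G_low)
  have F_high: "F q y = 1" if "1 \<le> q" for q y
    using that by (simp add: F_def G_high)
  obtain \<kappa> :: "'c \<Rightarrow> real measure"
    where \<kappa> [measurable]: "\<kappa> \<in> Y \<rightarrow>\<^sub>M prob_algebra borel"
    and lim_\<kappa>: "\<forall>y\<in>space Y. \<forall>(t :: real) q. (\<forall>n. t < of_rat (q n)) \<longrightarrow>
      (\<lambda>n. of_rat (q n)) \<longlonglongrightarrow> t \<longrightarrow> (\<lambda>n. F (q n) y) \<longlonglongrightarrow> measure (\<kappa> y) {..t}"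
    using rational_cdf_kernel[of F Y, OF F_meas F_mono F_low F_high] by blast
  have prob_\<kappa>: "prob_space (\<kappa> y)" "sets (\<kappa> y) = sets borel" if "y \<in> space Y" for y
    using measurable_space[OF \<kappa> that] by (auto simp: space_prob_algebra)
  have \<kappa>_sub [measurable]: "\<kappa> \<in> Y \<rightarrow>\<^sub>M subprob_algebra borel"
    by (rule measurable_prob_algebraD) fact
  \<comment> \<open>Both sides are limits along rationals tending to \<open>t\<close> from above:
    the left by \<open>lim_\<kappa>\<close>, the right because the indicators of the events converge
    pointwise. At the rationals they agree since \<open>F\<close> equals \<open>g\<close> almost
    everywhere.\<close>
  have J_eq: "(\<integral>\<^sup>+ y\<in>B. emeasure (\<kappa> y) {..t} \<partial>\<eta>) = J t B" if B [measurable]: "B \<in> sets Y" for B t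
  proof -
    obtain q :: "nat \<Rightarrow> rat" where q: "\<And>n. t < of_rat (q n)" "(\<lambda>n. of_rat (q n) :: real) \<longlonglongrightarrow> t"
      by (rule ex_rat_sequence_at_right) blast
    have "(\<lambda>n. \<integral>\<^sup>+ y\<in>B. ennreal (F (q n) y) \<partial>\<eta>) \<longlonglongrightarrow> (\<integral>\<^sup>+ y\<in>B. emeasure (\<kappa> y) {..t} \<partial>\<eta>)"
    proof (rule nn_integral_dominated_convergence[where w = "\<lambda>_. 1"])
      show "AE y in \<eta>. ennreal (F (q n) y) * indicator B y \<le> 1" for n
        using F_range by (auto simp: indicator_def)
      show "AE y in \<eta>. (\<lambda>n. ennreal (F (q n) y) * indicator B y) \<longlonglongrightarrow>
          emeasure (\<kappa> y) {..t} * indicator B y"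
      proof (rule AE_I2)
        fix y assume "y \<in> space \<eta>"
        then have y: "y \<in> space Y" by (simp add: space_\<eta>)
        interpret \<kappa>y: prob_space "\<kappa> y" by (rule prob_\<kappa>[OF y])
        show "(\<lambda>n. ennreal (F (q n) y) * indicator B y) \<longlonglongrightarrow> emeasure (\<kappa> y) {..t} * indicator B y"
          using lim_\<kappa>[rule_format, OF y q]
          by (cases "y \<in> B") (auto simp: \<kappa>y.emeasure_eq_measure intro!: tendsto_ennrealI)
      qed
    qed (auto simp: \<eta>.emeasure_space_1)
    moreover have "(\<integral>\<^sup>+ y\<in>B. ennreal (F (q n) y) \<partial>\<eta>) = J (of_rat (q n)) B" for n
    proof -
      have "(\<integral>\<^sup>+ y\<in>B. ennreal (F (q n) y) \<partial>\<eta>) = (\<integral>\<^sup>+ y\<in>B. g (of_rat (q n)) y \<partial>\<eta>)"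
        by (rule nn_integral_cong_AE) (use AE_G in \<open>eventually_elim, simp add: ennreal_F\<close>)
      then show ?thesis by (simp add: int_g)
    qed
    moreover have "(\<lambda>n. J (of_rat (q n)) B) \<longlonglongrightarrow> J t B"
    proof -
      have "(\<lambda>n. \<integral>\<^sup>+ x. indicator {x \<in> space M. f x \<le> of_rat (q n) \<and> h x \<in> B} x \<partial>M) \<longlonglongrightarrow>
          (\<integral>\<^sup>+ x. indicator {x \<in> space M. f x \<le> t \<and> h x \<in> B} x \<partial>M)"
      proof (rule nn_integral_dominated_convergence[where w = "\<lambda>_. 1"])
        show "AE x in M. (\<lambda>n. indicator {x \<in> space M. f x \<le> of_rat (q n) \<and> h x \<in> B} x :: ennreal) \<longlonglongrightarrow>
            indicator {x \<in> space M. f x \<le> t \<and> h x \<in> B} x"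
        proof (rule AE_I2, rule tendsto_eventually)
          fix x
          show "\<forall>\<^sub>F n in sequentially. indicator {x \<in> space M. f x \<le> of_rat (q n) \<and> h x \<in> B} x =
              (indicator {x \<in> space M. f x \<le> t \<and> h x \<in> B} x :: ennreal)"
          proof (cases "f x \<le> t")
            case True
            then have "f x \<le> of_rat (q n)" for n using q(1)[of n] by simp
            with True show ?thesis by (auto simp: indicator_def)
          next
            case False
            then have "\<forall>\<^sub>F n in sequentially. of_rat (q n) < f x"
              using q(2) by (intro order_tendstoD) auto
            then show ?thesis by eventually_elim (use False in \<open>auto simp: indicator_def\<close>)
          qed
        qed
      qed (auto simp: emeasure_space_1 indicator_def)
      then show ?thesis by (simp add: J_def)
    qed
    ultimately show ?thesis
      using LIMSEQ_unique by force
  qed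
  have "(\<integral>\<^sup>+ y\<in>B. emeasure (\<kappa> y) A \<partial>\<eta>) = emeasure M {x \<in> space M. f x \<in> A \<and> h x \<in> B}"
    if A [measurable]: "A \<in> sets borel" and B [measurable]: "B \<in> sets Y" for A B
  proof -
    \<comment> \<open>For fixed \<open>B\<close> the two sides are finite measures in
      \<open>A\<close>. By \<open>J_eq\<close> they agree on half-lines, hence on all Borel
      sets.\<close>
    define \<mu>1 where "\<mu>1 = density \<eta> (indicator B) \<bind> \<kappa>"
    define \<mu>2 where "\<mu>2 = distr (density M (indicator (h -` B \<inter> space M))) borel f"
    have ne: "space \<eta> \<noteq> {}" by (rule \<eta>.not_empty)
    have em1: "emeasure \<mu>1 C = (\<integral>\<^sup>+ y\<in>B. emeasure (\<kappa> y) C \<partial>\<eta>)" if "C \<in> sets borel" for C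
      unfolding \<mu>1_def using ne that
      by (subst emeasure_bind[where N = borel])
         (auto simp: nn_integral_density mult.commute intro!: nn_integral_cong)
    have em2: "emeasure \<mu>2 C = emeasure M {x \<in> space M. f x \<in> C \<and> h x \<in> B}"
      if [measurable]: "C \<in> sets borel" for C
    proof -
      have "emeasure \<mu>2 C = (\<integral>\<^sup>+ x. indicator (h -` B \<inter> space M) x * indicator (f -` C \<inter> space M) x \<partial>M)"
        by (simp add: \<mu>2_def emeasure_distr emeasure_density)
      also have "\<dots> = (\<integral>\<^sup>+ x. indicator {x \<in> space M. f x \<in> C \<and> h x \<in> B} x \<partial>M)"
        by (rule nn_integral_cong) (auto simp: indicator_def)
      finally show ?thesis by simp
    qed
    have sets1: "sets \<mu>1 = sets borel"
      unfolding \<mu>1_def using ne prob_\<kappa> by (intro sets_bind) (auto simp: space_\<eta>)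
    have sets2: "sets \<mu>2 = sets borel" by (simp add: \<mu>2_def)
    have "\<mu>1 = \<mu>2"
    proof (rule measure_eqI_generator_eq[where \<Omega> = UNIV and E = "range atMost" and A = "\<lambda>n. {..real n}"])
      show "Int_stable (range (atMost :: real \<Rightarrow> real set))"
        by (auto simp: Int_stable_def)
      show "sets \<mu>1 = sigma_sets UNIV (range atMost)" "sets \<mu>2 = sigma_sets UNIV (range atMost)"
        by (simp_all only: sets1 sets2 sets_borel_eq_sigma_sets_atMost)
      show "emeasure \<mu>1 C = emeasure \<mu>2 C" if "C \<in> range atMost" for C
        using that by (auto simp: em1 em2 J_eq) (simp add: J_def)
      show "emeasure \<mu>1 {..real n} \<noteq> \<infinity>" for n
        by (simp add: em1 J_eq) (simp add: J_def)
      show "(\<Union>n. {..real n}) = UNIV"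
        using real_arch_simple by auto
    qed auto
    then show ?thesis using em1[OF A] em2[OF A] by simp
  qed
  with \<kappa> show ?thesis unfolding \<eta>_def by blast
qed

section \<open>Standard Borel spaces as retracts of the reals\<close>

text \<open>In base two a sequence ending in ones can share its sum with another sequence; base
  three with digits 0 and 1 keeps the coding injective. The first place after the point is
  \<open>k = 0\<close>.\<close>

definition ternary_digit :: "nat \<Rightarrow> real \<Rightarrow> bool" where
  "ternary_digit k r \<longleftrightarrow> \<lfloor>3 ^ Suc k * r\<rfloor> mod 3 = 1"

lemma ternary_digit_measurable [measurable]:
  "Measurable.pred borel (ternary_digit k)"
  unfolding ternary_digit_def by measurable

lemma summable_ternary: "summable (\<lambda>k. of_bool (b k) / (3::real) ^ Suc k)"
proof (rule summable_comparison_test'[where N = 0])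
  show "summable (\<lambda>k. (1/3::real) ^ Suc k)" by (subst summable_Suc_iff) (rule summable_geometric, simp)
qed (simp add: power_divide)

text \<open>The extreme case is all digits 1, a geometric series with sum 1/2. Besides placing codes
  in the unit interval, a bound below 1 makes tails invisible to the floor function.\<close>

lemma suminf_ternary_bounds:
  "(\<Sum>k. of_bool (b k) / (3::real) ^ Suc k) \<in> {0..1/2}"
proof -
  have "(\<lambda>k. 1/3 * (1/3::real) ^ k) sums (1/3 * (1 / (1 - 1/3)))"
    by (intro sums_mult geometric_sums) simp
  then have s: "(\<lambda>k. (1/3::real) ^ Suc k) sums (1/2)" by simp
  have "(\<Sum>k. of_bool (b k) / (3::real) ^ Suc k) \<le> (\<Sum>k. (1/3::real) ^ Suc k)"
    by (rule suminf_le[OF _ summable_ternary sums_summable[OF s]]) (simp add: power_divide)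
  moreover have "0 \<le> (\<Sum>k. of_bool (b k) / (3::real) ^ Suc k)"
    by (rule suminf_nonneg[OF summable_ternary]) simp
  ultimately show ?thesis using sums_unique[OF s] by simp
qed

text \<open>Only the digits 0 and 1 occur, so the tail of the series is at most half a unit of the
  current digit and never carries.\<close>

lemma ternary_digit_suminf:
  "ternary_digit k (\<Sum>j. of_bool (b j) / (3::real) ^ Suc j) \<longleftrightarrow> b k"
proof -
  \<comment> \<open>Multiplying \<open>S\<close> by \<open>3 ^ Suc k\<close> shifts the point:
    \<open>m\<close> is the integer spelled by the first \<open>k\<close> digits, \<open>b k\<close>
    becomes the units digit, and \<open>T\<close> is the fractional part.\<close>
  define S where "S = (\<Sum>j. of_bool (b j) / (3::real) ^ Suc j)"
  define T where "T = (\<Sum>j. of_bool (b (j + Suc k)) / (3::real) ^ Suc j)"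
  define m :: int where "m = (\<Sum>j<k. of_bool (b j) * 3 ^ (k - Suc j))"
  have "S = (\<Sum>j. of_bool (b (j + Suc k)) / (3::real) ^ Suc (j + Suc k)) +
      (\<Sum>j<Suc k. of_bool (b j) / (3::real) ^ Suc j)"
    unfolding S_def by (rule suminf_split_initial_segment[OF summable_ternary])
  also have "(\<Sum>j. of_bool (b (j + Suc k)) / (3::real) ^ Suc (j + Suc k)) = T / 3 ^ Suc k"
    unfolding T_def by (subst suminf_divide[OF summable_ternary, symmetric]) (simp add: power_add)
  finally have "3 ^ Suc k * S = T + 3 ^ Suc k * (\<Sum>j<Suc k. of_bool (b j) / (3::real) ^ Suc j)"
    by (simp add: field_simps)
  also have "3 ^ Suc k * (\<Sum>j<Suc k. of_bool (b j) / (3::real) ^ Suc j) =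
      of_int (3 * m + of_bool (b k))"
  proof -
    have "3 ^ Suc k * (of_bool (b j) / (3::real) ^ Suc j) = 3 * (of_bool (b j) * 3 ^ (k - Suc j))"
      if "j < k" for j
    proof -
      have "(3::real) ^ Suc k = 3 ^ Suc j * (3 * 3 ^ (k - Suc j))"
        using that by (simp flip: power_add power_Suc)
      then show ?thesis by simp
    qed
    then have "(\<Sum>j<k. 3 ^ Suc k * (of_bool (b j) / (3::real) ^ Suc j)) =
        (\<Sum>j<k. 3 * (of_bool (b j) * 3 ^ (k - Suc j)))"
      by (intro sum.cong) auto
    also have "\<dots> = 3 * of_int m"
      by (simp add: m_def sum_distrib_left del: sum_of_bool_mult_eq sum_mult_of_bool_eq)
    finally show ?thesis
      by (simp add: sum_distrib_left distrib_left
          del: sum_of_bool_mult_eq sum_mult_of_bool_eq power_Suc)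
  qed
  finally have "\<lfloor>3 ^ Suc k * S\<rfloor> = 3 * m + of_bool (b k)"
    using suminf_ternary_bounds[of "\<lambda>j. b (j + Suc k)"] unfolding T_def[symmetric]
    by (intro floor_unique) auto
  then show ?thesis unfolding ternary_digit_def S_def[symmetric]
    by (cases "b k") auto
qed

text \<open>For open \<open>U\<close>, terms inside \<open>U\<close> may converge to its boundary,
  so eventual membership in \<open>U\<close> does not decide where the limit lies. Eventual
  membership in one of countably many open sets \<open>V k\<close>, each keeping a positive distance
  from the complement of \<open>U\<close>, does.\<close>

lemma (in Metric_space) measurable_limit:
  fixes s :: "nat \<Rightarrow> 'b \<Rightarrow> 'a"
  assumes sets_N: "sets N = sigma_sets M {U. openin mtopology U}" and space_N: "space N = M"
    and s: "\<And>n. s n \<in> R \<rightarrow>\<^sub>M N"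
    and lim: "\<And>r. r \<in> space R \<Longrightarrow> limitin mtopology (\<lambda>n. s n r) (l r) sequentially"
  shows "l \<in> R \<rightarrow>\<^sub>M N"
proof (rule measurable_sigma_sets[OF sets_N])
  show "{U. openin mtopology U} \<subseteq> Pow M"
    using openin_subset by fastforce
  show "l \<in> space R \<rightarrow> M"
    using lim by (auto simp: limit_metric_sequentially)
  fix U assume "U \<in> {U. openin mtopology U}"
  then have U: "openin mtopology U" by simp
  define V where "V k = (\<Union>x\<in>{x. mball x (2 * inverse (Suc k)) \<subseteq> U}. mball x (inverse (Suc k)))" for k :: nat
  have V [measurable]: "V k \<in> sets N" for k
  proof -
    have "openin mtopology (V k)" unfolding V_def by (intro openin_Union) auto
    then show ?thesis unfolding sets_N by (intro sigma_sets.Basic) simp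
  qed
  have "l r \<in> U \<longleftrightarrow> (\<exists>k m. \<forall>n\<ge>m. s n r \<in> V k)" if "r \<in> space R" for r
  proof
    assume "l r \<in> U"
    then obtain e where e: "0 < e" "mball (l r) e \<subseteq> U"
      using U by (auto simp: openin_mtopology)
    obtain k :: nat where "inverse (Suc k) < e / 2"
      using reals_Archimedean[of "e / 2"] e by auto
    then have "mball (l r) (2 * inverse (Suc k)) \<subseteq> mball (l r) e"
      by (intro mball_subset_concentric) simp
    then have "mball (l r) (inverse (Suc k)) \<subseteq> V k"
      using e unfolding V_def by blast
    moreover obtain m where "\<forall>n\<ge>m. s n r \<in> M \<and> d (s n r) (l r) < inverse (Suc k)"
      using lim[OF \<open>r \<in> space R\<close>] unfolding limit_metric_sequentially
      by (metis inverse_positive_iff_positive of_nat_0_less_iff zero_less_Suc)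
    ultimately have "\<forall>n\<ge>m. s n r \<in> V k"
      using lim[OF that] by (auto simp: limit_metric_sequentially commute subset_iff)
    then show "\<exists>k m. \<forall>n\<ge>m. s n r \<in> V k" by blast
  next
    assume "\<exists>k m. \<forall>n\<ge>m. s n r \<in> V k"
    then obtain k m where m: "\<And>n. m \<le> n \<Longrightarrow> s n r \<in> V k" by blast
    obtain m' where m': "\<forall>n\<ge>m'. s n r \<in> M \<and> d (s n r) (l r) < inverse (Suc k)"
      using lim[OF \<open>r \<in> space R\<close>] unfolding limit_metric_sequentially
      by (metis inverse_positive_iff_positive of_nat_0_less_iff zero_less_Suc)
    define y where "y = s (max m m') r"
    have "y \<in> V k" and y: "d y (l r) < inverse (Suc k)"
      using m[of "max m m'"] m' by (auto simp: y_def)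
    then obtain x where x: "mball x (2 * inverse (Suc k)) \<subseteq> U" "y \<in> mball x (inverse (Suc k))"
      by (auto simp: V_def simp del: in_mball)
    moreover have "l r \<in> M" using lim[OF that] by (simp add: limit_metric_sequentially)
    ultimately have "l r \<in> mball x (2 * inverse (Suc k))"
      using y triangle[of x y "l r"] by auto
    then show "l r \<in> U" using x by blast
  qed
  then have "l -` U \<inter> space R = {r \<in> space R. \<exists>k m. \<forall>n\<ge>m. s n r \<in> V k}"
    by auto
  also have "\<dots> \<in> sets R"
    using s by measurable
  finally show "l -` U \<inter> space R \<in> sets R" .
qed

text \<open>The code of \<open>x\<close> records which balls of radius \<open>1/(n+1)\<close> around points of a countable
  dense set contain \<open>x\<close>. By completeness decoding is a limit wherever it makes sense, so the
  image of the encoding need not be known to be Borel.\<close>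

lemma standard_borel_real_retract:
  assumes "standard_borel X" and ne: "space X \<noteq> {}"
  obtains f :: "'a \<Rightarrow> real" and g where
    "f \<in> borel_measurable X" "g \<in> borel \<rightarrow>\<^sub>M X"
    "\<And>x. x \<in> space X \<Longrightarrow> f x \<in> {0..1}" "\<And>x. x \<in> space X \<Longrightarrow> g (f x) = x"
proof -
  obtain T where T: "topspace T = space X" "completely_metrizable_space T" "second_countable T"
      "sets X = sigma_sets (space X) {U. openin T U}"
    using assms by (auto simp: standard_borel_def)
  then obtain M d where "Metric_space M d" and compl: "Metric_space.mcomplete M d"
      and T_eq: "T = Metric_space.mtopology M d"
    by (auto simp: completely_metrizable_space_def)
  interpret Metric_space M d by fact
  have M: "space X = M" using T by (simp add: T_eq)
  have sets_X: "sets X = sigma_sets M {U. openin mtopology U}"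
    using T by (simp add: T_eq M)
  obtain C where C: "countable C" "C \<subseteq> M" "mtopology closure_of C = M"
    using second_countable_imp_separable_space[OF T(3)] by (auto simp: separable_space_def T_eq)
  have "C \<noteq> {}" using C(3) ne M by auto
  define q where "q = from_nat_into C"
  have q: "q i \<in> M" for i
    using from_nat_into[OF \<open>C \<noteq> {}\<close>] C(2) by (auto simp: q_def)
  have dense: "\<exists>i. d x (q i) < e" if "x \<in> M" "0 < e" for x e
  proof -
    have "x \<in> mtopology closure_of C" using that C by simp
    then obtain y where y: "y \<in> C" "d x y < e" using \<open>0 < e\<close> by (auto simp: metric_closure_of)
    then show ?thesis using from_nat_into_surj[OF C(1) y(1)] by (auto simp: q_def)
  qed
  define b where "b x k = (case prod_decode k of (n, i) \<Rightarrow> d x (q i) < inverse (Suc n))" for x k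
  define f where "f x = (\<Sum>k. of_bool (b x k) / (3::real) ^ Suc k)" for x
  have [measurable]: "Measurable.pred X (\<lambda>x. b x k)" for k
  proof -
    obtain n i where ni: "prod_decode k = (n, i)" by fastforce
    have "mball (q i) (inverse (Suc n)) \<in> sets X"
      unfolding sets_X by (intro sigma_sets.Basic) simp
    moreover have "{x \<in> space X. b x k} = mball (q i) (inverse (Suc n))"
      using q by (auto simp: b_def ni M commute)
    ultimately show ?thesis by (simp add: pred_def)
  qed
  have f: "f \<in> borel_measurable X"
    unfolding f_def by measurable
  \<comment> \<open>Where no ball of the given radius is recorded, \<open>LEAST\<close> returns an
    unspecified index. This is harmless: only codes \<open>f x\<close> must be decoded correctly,
    and for these density provides a recorded ball.\<close>
  define idx where "idx n r = (LEAST i. ternary_digit (prod_encode (n, i)) r)" for n r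
  have [measurable]: "idx n \<in> borel \<rightarrow>\<^sub>M count_space UNIV" for n
    unfolding idx_def by measurable
  have q_meas: "q \<in> count_space UNIV \<rightarrow>\<^sub>M X" using q by (simp add: M)
  \<comment> \<open>The reals whose decoded centres form a Cauchy sequence. Elsewhere
    \<open>s\<close> is constant, so that it converges at every real and the limit \<open>g\<close>
    is defined on the whole line.\<close>
  define R where "R = {r. \<forall>k. \<exists>N. \<forall>n\<ge>N. \<forall>m\<ge>N. d (q (idx n r)) (q (idx m r)) < inverse (Suc k)}"
  \<comment> \<open>Both arguments depend on \<open>r\<close> only through countable indices, so
    measurability of \<open>d\<close> does not enter.\<close>
  have [measurable]: "(\<lambda>r. d (q (idx n r)) (q (idx m r))) \<in> borel_measurable borel" for n m
  proof (rule measurable_compose_countable[where g = "idx n"])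
    show "(\<lambda>r. d (q i) (q (idx m r))) \<in> borel_measurable borel" for i
      by (rule measurable_compose[where f = "idx m" and N = "count_space UNIV"]) auto
  qed simp
  have R [measurable]: "R \<in> sets borel"
    unfolding R_def by measurable
  define s where "s n r = (if r \<in> R then q (idx n r) else q 0)" for n r
  have s: "s n \<in> borel \<rightarrow>\<^sub>M X" for n
    unfolding s_def using q
    by (intro measurable_If_set measurable_compose[OF _ q_meas]) (auto simp: M)
  have "MCauchy (\<lambda>n. s n r)" for r
  proof (cases "r \<in> R")
    case True
    have "\<exists>N. \<forall>n n'. N \<le> n \<longrightarrow> N \<le> n' \<longrightarrow> d (s n r) (s n' r) < e" if "0 < e" for e
    proof -
      obtain k where k: "inverse (real (Suc k)) < e" using reals_Archimedean[OF \<open>0 < e\<close>] by blast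
      obtain N where "\<forall>n\<ge>N. \<forall>m\<ge>N. d (q (idx n r)) (q (idx m r)) < inverse (Suc k)"
        using True unfolding R_def by blast
      then show ?thesis using True k by (auto simp: s_def intro!: exI[of _ N] intro: less_trans)
    qed
    then show ?thesis using q by (auto simp: MCauchy_def s_def)
  next
    case False
    then show ?thesis using q by (simp add: s_def)
  qed
  then have "\<exists>l. limitin mtopology (\<lambda>n. s n r) l sequentially" for r
    using compl by (simp add: mcomplete_def)
  then obtain g where lim: "\<And>r. limitin mtopology (\<lambda>n. s n r) (g r) sequentially"
    by metis
  show ?thesis
  proof
    show "f \<in> borel_measurable X" by fact
    show "g \<in> borel \<rightarrow>\<^sub>M X" using sets_X M s lim by (rule measurable_limit)
    show "f x \<in> {0..1}" for x
      using suminf_ternary_bounds[of "b x"] by (auto simp: f_def)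
    fix x assume "x \<in> space X"
    then have x: "x \<in> M" by (simp add: M)
    have digit: "ternary_digit (prod_encode (n, i)) (f x) \<longleftrightarrow> d x (q i) < inverse (Suc n)" for n i
      unfolding f_def ternary_digit_suminf by (simp add: b_def)
    have near: "d x (q (idx n (f x))) < inverse (Suc n)" for n
    proof -
      obtain i where "d x (q i) < inverse (Suc n)" using dense[OF x, of "inverse (Suc n)"] by auto
      then show ?thesis unfolding idx_def digit by (rule LeastI)
    qed
    have conv: "limitin mtopology (\<lambda>n. q (idx n (f x))) x sequentially"
      unfolding limitin_metric_dist_null
    proof (intro conjI x)
      show "((\<lambda>n. d (q (idx n (f x))) x) \<longlongrightarrow> 0) sequentially"
      proof (rule tendsto_sandwich[of "\<lambda>_. 0"])
        show "\<forall>\<^sub>F n in sequentially. d (q (idx n (f x))) x \<le> inverse (Suc n)"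
          using near by (auto simp: commute intro!: always_eventually less_imp_le)
      qed (use LIMSEQ_inverse_real_of_nat in auto)
    qed (use q in simp)
    \<comment> \<open>Convergence to \<open>x\<close> puts \<open>f x\<close> into \<open>R\<close>,
      so \<open>s\<close> is the decoded sequence there and uniqueness of limits identifies
      \<open>g (f x)\<close> with \<open>x\<close>.\<close>
    have "MCauchy (\<lambda>n. q (idx n (f x)))"
      using conv q by (intro convergent_imp_MCauchy) auto
    then have "f x \<in> R"
      unfolding R_def MCauchy_def by (simp del: of_nat_Suc)
    then have "limitin mtopology (\<lambda>n. q (idx n (f x))) (g (f x)) sequentially"
      using lim[of "f x"] by (simp add: s_def)
    then show "g (f x) = x"
      using conv by (rule limitin_metric_unique) simp
  qed
qed

section \<open>Regular conditional distributions\<close>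

text \<open>Disintegrate the real variable \<open>f x\<close> and push the resulting kernel forward
  along \<open>g\<close>. Since \<open>g\<close> inverts \<open>f\<close>, the event that
  \<open>f x\<close> lies in the preimage of \<open>A\<close> under \<open>g\<close> is the event
  that \<open>x\<close> lies in \<open>A\<close>.\<close>

lemma regular_conditional_distribution:
  assumes X: "standard_borel X" and p: "p \<in> space (prob_algebra (X \<Otimes>\<^sub>M Y))"
  obtains \<kappa> where "\<kappa> \<in> markov_kernels Y X"
    and "\<And>A B. A \<in> sets X \<Longrightarrow> B \<in> sets Y \<Longrightarrow>
      (\<integral>\<^sup>+ y\<in>B. emeasure (\<kappa> y) A \<partial>marginal_y Y p) = emeasure p (A \<times> B)"
proof -
  have sets_p [measurable_cong]: "sets p = sets (X \<Otimes>\<^sub>M Y)" and "prob_space p"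
    using p by (simp_all add: space_prob_algebra)
  interpret p: prob_space p by fact
  have space_p: "space p = space X \<times> space Y"
    using sets_eq_imp_space_eq[OF sets_p] by (simp add: space_pair_measure)
  have "space X \<noteq> {}" using p.not_empty by (auto simp: space_p)
  then obtain f g where f [measurable]: "f \<in> borel_measurable X"
    and g [measurable]: "g \<in> borel \<rightarrow>\<^sub>M X"
    and f_range: "\<And>x. x \<in> space X \<Longrightarrow> f x \<in> {0..1::real}"
    and g_f: "\<And>x. x \<in> space X \<Longrightarrow> g (f x) = x"
    using standard_borel_real_retract[OF X] by metis
  obtain \<kappa> where \<kappa> [measurable]: "\<kappa> \<in> Y \<rightarrow>\<^sub>M prob_algebra borel"
    and int_\<kappa>: "\<forall>A\<in>sets borel. \<forall>B\<in>sets Y. (\<integral>\<^sup>+ y\<in>B. emeasure (\<kappa> y) A \<partial>distr p Y snd) =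
      emeasure p {w \<in> space p. f (fst w) \<in> A \<and> snd w \<in> B}"
  proof -
    have fst_m: "(\<lambda>w. f (fst w)) \<in> borel_measurable p" and snd_m: "snd \<in> p \<rightarrow>\<^sub>M Y"
      by measurable
    have "f (fst w) \<in> {0..1}" if "w \<in> space p" for w
      using that by (intro f_range) (auto simp: space_p)
    from p.real_disintegration[OF fst_m snd_m this] show ?thesis using that by blast
  qed
  show ?thesis
  proof
    show "(\<lambda>y. distr (\<kappa> y) X g) \<in> markov_kernels Y X" by measurable
    fix A B assume [measurable]: "A \<in> sets X" "B \<in> sets Y"
    have "(\<integral>\<^sup>+ y\<in>B. emeasure (distr (\<kappa> y) X g) A \<partial>marginal_y Y p) =
        (\<integral>\<^sup>+ y\<in>B. emeasure (\<kappa> y) (g -` A) \<partial>distr p Y snd)"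
      unfolding marginal_y_def
    proof (rule nn_integral_cong)
      fix y assume "y \<in> space (distr p Y snd)"
      then have "sets (\<kappa> y) = sets borel"
        using measurable_space[OF \<kappa>] by (simp add: space_prob_algebra)
      then have [measurable_cong]: "sets (\<kappa> y) = sets borel" and "space (\<kappa> y) = UNIV"
        using sets_eq_imp_space_eq by fastforce+
      then show "emeasure (distr (\<kappa> y) X g) A * indicator B y = emeasure (\<kappa> y) (g -` A) * indicator B y"
        by (simp add: emeasure_distr)
    qed
    also have "\<dots> = emeasure p {w \<in> space p. f (fst w) \<in> g -` A \<and> snd w \<in> B}"
      using measurable_sets[OF g \<open>A \<in> sets X\<close>] by (intro int_\<kappa>[rule_format]) simp_all
    also have "{w \<in> space p. f (fst w) \<in> g -` A \<and> snd w \<in> B} = A \<times> B"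
      using sets.sets_into_space[OF \<open>A \<in> sets X\<close>] sets.sets_into_space[OF \<open>B \<in> sets Y\<close>]
      by (auto simp: space_p g_f subset_iff)
    finally show "(\<integral>\<^sup>+ y\<in>B. emeasure (distr (\<kappa> y) X g) A \<partial>marginal_y Y p) = emeasure p (A \<times> B)" .
  qed
qed

text \<open>Rectangles form an intersection-stable generator. On \<open>A \<times> B\<close> the
  inner kernel has mass \<open>emeasure (\<kappa> y) A * indicator B y\<close>, so
  \<open>rect\<close> gives equality there.\<close>

lemma joint_eq_disintegration:
  assumes p: "p \<in> space (prob_algebra (X \<Otimes>\<^sub>M Y))" and \<kappa>: "\<kappa> \<in> markov_kernels Y X"
    and rect: "\<And>A B. A \<in> sets X \<Longrightarrow> B \<in> sets Y \<Longrightarrow>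
      (\<integral>\<^sup>+ y\<in>B. emeasure (\<kappa> y) A \<partial>marginal_y Y p) = emeasure p (A \<times> B)"
  shows "marginal_y Y p \<bind> (\<lambda>y. \<kappa> y \<bind> (\<lambda>x. return (X \<Otimes>\<^sub>M Y) (x, y))) = p"
    (is "?q = p")
proof -
  note [measurable] = \<kappa>
  have sets_p: "sets p = sets (X \<Otimes>\<^sub>M Y)" and "prob_space p"
    using p by (simp_all add: space_prob_algebra)
  interpret p: prob_space p by fact
  have py: "marginal_y Y p \<in> space (prob_algebra Y)" by (rule marginal_y_in_prob_algebra[OF p])
  have K: "(\<lambda>y. \<kappa> y \<bind> (\<lambda>x. return (X \<Otimes>\<^sub>M Y) (x, y))) \<in> Y \<rightarrow>\<^sub>M prob_algebra (X \<Otimes>\<^sub>M Y)"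
    by measurable
  let ?E = "{a \<times> b |a b. a \<in> sets X \<and> b \<in> sets Y}"
  have "p = ?q"
  proof (rule measure_eqI_generator_eq[OF Int_stable_pair_measure_generator[of X Y]])
    show "?E \<subseteq> Pow (space X \<times> space Y)"
      using sets.space_closed[of X] sets.space_closed[of Y] by auto
    show "sets p = sigma_sets (space X \<times> space Y) ?E"
      by (simp add: sets_p sets_pair_measure)
    show "sets ?q = sigma_sets (space X \<times> space Y) ?E"
      by (simp add: sets_bind'[OF py K] sets_pair_measure)
    show "range (\<lambda>_::nat. space X \<times> space Y) \<subseteq> ?E" by auto
    show "emeasure p (space X \<times> space Y) \<noteq> \<infinity>" by simp
    fix W assume "W \<in> ?E"
    then obtain A B where W: "W = A \<times> B" and [measurable]: "A \<in> sets X" "B \<in> sets Y" by auto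
    have "emeasure (\<kappa> y \<bind> (\<lambda>x. return (X \<Otimes>\<^sub>M Y) (x, y))) W = emeasure (\<kappa> y) A * indicator B y"
      if "y \<in> space Y" for y
    proof -
      note [measurable] = that
      have ky: "\<kappa> y \<in> space (prob_algebra X)" using measurable_space[OF \<kappa> that] .
      then have sets_ky [measurable_cong]: "sets (\<kappa> y) = sets X" by (simp add: space_prob_algebra)
      have "emeasure (\<kappa> y \<bind> (\<lambda>x. return (X \<Otimes>\<^sub>M Y) (x, y))) W =
          (\<integral>\<^sup>+ x. emeasure (return (X \<Otimes>\<^sub>M Y) (x, y)) W \<partial>\<kappa> y)"
        by (rule emeasure_bind_prob_algebra[OF ky, where L = "X \<Otimes>\<^sub>M Y"]) (auto simp: W)
      also have "\<dots> = (\<integral>\<^sup>+ x. indicator A x * indicator B y \<partial>\<kappa> y)"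
        by (rule nn_integral_cong) (auto simp: W indicator_def)
      also have "\<dots> = emeasure (\<kappa> y) A * indicator B y"
        by (simp add: nn_integral_multc)
      finally show ?thesis .
    qed
    then have "emeasure ?q W = (\<integral>\<^sup>+ y\<in>B. emeasure (\<kappa> y) A \<partial>marginal_y Y p)"
      by (subst emeasure_bind_prob_algebra[OF py K])
         (auto simp: W marginal_y_def intro!: nn_integral_cong)
    then show "emeasure p W = emeasure ?q W"
      by (simp add: rect W)
  qed auto
  then show ?thesis ..
qed

text \<open>This is \<open>rect\<close> with \<open>B = space Y\<close>.\<close>

lemma marginal_x_eq_disintegration:
  assumes p: "p \<in> space (prob_algebra (X \<Otimes>\<^sub>M Y))" and \<kappa>: "\<kappa> \<in> markov_kernels Y X"
    and rect: "\<And>A B. A \<in> sets X \<Longrightarrow> B \<in> sets Y \<Longrightarrow>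
      (\<integral>\<^sup>+ y\<in>B. emeasure (\<kappa> y) A \<partial>marginal_y Y p) = emeasure p (A \<times> B)"
  shows "marginal_y Y p \<bind> \<kappa> = marginal_x X p"
proof (rule measure_eqI)
  have py: "marginal_y Y p \<in> space (prob_algebra Y)" by (rule marginal_y_in_prob_algebra[OF p])
  have sets_p [measurable_cong]: "sets p = sets (X \<Otimes>\<^sub>M Y)"
    using p by (simp add: space_prob_algebra)
  have space_p: "space p = space X \<times> space Y"
    using sets_eq_imp_space_eq[OF sets_p] by (simp add: space_pair_measure)
  show sets: "sets (marginal_y Y p \<bind> \<kappa>) = sets (marginal_x X p)"
    using sets_bind'[OF py \<kappa>] by (simp add: marginal_x_def)
  fix A assume "A \<in> sets (marginal_y Y p \<bind> \<kappa>)"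
  then have [measurable]: "A \<in> sets X" using sets by (simp add: marginal_x_def)
  have "emeasure (marginal_y Y p \<bind> \<kappa>) A = (\<integral>\<^sup>+ y\<in>space Y. emeasure (\<kappa> y) A \<partial>marginal_y Y p)"
    by (subst emeasure_bind_prob_algebra[OF py \<kappa>])
       (auto simp: marginal_y_def intro!: nn_integral_cong)
  also have "\<dots> = emeasure p (A \<times> space Y)" by (simp add: rect)
  also have "A \<times> space Y = fst -` A \<inter> space p"
    using sets.sets_into_space[OF \<open>A \<in> sets X\<close>] by (auto simp: space_p)
  also have "emeasure p \<dots> = emeasure (marginal_x X p) A"
    by (simp add: marginal_x_def emeasure_distr)
  finally show "emeasure (marginal_y Y p \<bind> \<kappa>) A = emeasure (marginal_x X p) A" .
qed

section \<open>Discriminator games\<close>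

text \<open>The common shape of \<open>L_xy\<close> and \<open>L_xz\<close>: both depend on
  generator and inference conditional only through a pair of laws.\<close>

definition gan_value :: "'a measure \<Rightarrow> 'a measure \<Rightarrow> ('a \<Rightarrow> real) \<Rightarrow> ereal" where
  "gan_value \<mu> \<nu> D = expectation_nonpos \<mu> (\<lambda>w. ext_log (D w)) +
     expectation_nonpos \<nu> (\<lambda>w. ext_log (1 - D w))"

lemma gan_value_half:
  assumes "prob_space \<mu>" and "prob_space \<nu>"
  shows "gan_value \<mu> \<nu> (\<lambda>_. 1 / 2) = ereal (- 2 * ln 2)"
proof -
  have "expectation_nonpos M (\<lambda>_. ext_log (1 / 2)) = ereal (- ln 2)" if "prob_space M" for M :: "'a measure"
    using prob_space.emeasure_space_1[OF that]
    by (simp add: expectation_nonpos_def ext_log_def ln_div e2ennreal_ereal)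
  then show ?thesis using assms by (simp add: gan_value_def)
qed

lemma e2ennreal_ext_log_add_ge:
  assumes "a \<in> {0..1}"
  shows "ennreal (2 * ln 2) \<le> e2ennreal (- ext_log a) + e2ennreal (- ext_log (1 - a))"
proof (cases "a = 0 \<or> a = 1")
  \<comment> \<open>At an endpoint one of the two logarithms is minus infinity, so the right-hand
    side is infinite.\<close>
  case True
  then show ?thesis by (auto simp: ext_log_def)
next
  case False
  with assms have a: "0 < a" "a < 1" by auto
  have "0 \<le> (a - 1/2)\<^sup>2" by simp
  then have "a * (1 - a) \<le> 1 / 4" by (simp add: power2_eq_square algebra_simps)
  then have "ln (a * (1 - a)) \<le> ln (1 / 4)" using a by simp
  moreover have "ln (1 / 4 :: real) = - (2 * ln 2)"
    using ln_realpow[of 2 2] by (simp add: ln_div)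
  ultimately have "2 * ln 2 \<le> - ln a + - ln (1 - a)" using a by (simp add: ln_mult)
  then show ?thesis
    using a by (simp add: ext_log_def e2ennreal_ereal ennreal_leI flip: ennreal_plus)
qed

text \<open>Under a single law the two expectations merge into one integral, to which the pointwise
  bound applies.\<close>

lemma gan_value_same_le:
  assumes "prob_space \<mu>" and sets: "sets \<mu> = sets S" and D: "D \<in> discriminators S"
  shows "gan_value \<mu> \<mu> D \<le> ereal (- 2 * ln 2)"
proof -
  interpret prob_space \<mu> by fact
  note [measurable_cong] = sets
  have [measurable]: "D \<in> borel_measurable S"
    using D by (simp add: measurable_restrict_space2_iff)
  have range_D: "D w \<in> {0..1}" if "w \<in> space \<mu>" for w
    using D that sets_eq_imp_space_eq[OF sets] by (auto simp: measurable_restrict_space2_iff)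
  have [measurable]: "ext_log \<in> borel_measurable borel"
    unfolding ext_log_def by measurable
  let ?I = "\<integral>\<^sup>+ w. e2ennreal (- ext_log (D w)) \<partial>\<mu>" and ?J = "\<integral>\<^sup>+ w. e2ennreal (- ext_log (1 - D w)) \<partial>\<mu>"
  have "ennreal (2 * ln 2) = (\<integral>\<^sup>+ w. ennreal (2 * ln 2) \<partial>\<mu>)"
    by (simp add: emeasure_space_1)
  also have "\<dots> \<le> (\<integral>\<^sup>+ w. e2ennreal (- ext_log (D w)) + e2ennreal (- ext_log (1 - D w)) \<partial>\<mu>)"
    by (intro nn_integral_mono e2ennreal_ext_log_add_ge range_D)
  also have "\<dots> = ?I + ?J" by (rule nn_integral_add) measurable
  finally have "enn2ereal (ennreal (2 * ln 2)) \<le> enn2ereal (?I + ?J)"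
    by (simp add: less_eq_ennreal.rep_eq)
  then have "ereal (2 * ln 2) \<le> enn2ereal ?I + enn2ereal ?J"
    by (simp add: plus_ennreal.rep_eq)
  \<comment> \<open>Negation distributes over the sum because both integrals are nonnegative, so
    opposite infinities never meet.\<close>
  moreover have "gan_value \<mu> \<mu> D = - (enn2ereal ?I + enn2ereal ?J)"
    unfolding gan_value_def expectation_nonpos_def
    using enn2ereal_nonneg[of ?I] enn2ereal_nonneg[of ?J]
    by (cases "enn2ereal ?I"; cases "enn2ereal ?J") auto
  ultimately have "gan_value \<mu> \<mu> D \<le> - ereal (2 * ln 2)" by (simp only: ereal_minus_le_minus)
  then show ?thesis by simp
qed

lemma const_discriminator: "(\<lambda>_. 1 / 2) \<in> discriminators S"
  by (rule measurable_const) (simp add: space_restrict_space)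

text \<open>The constant discriminator is available against every pair of laws, so competing
  generators are bounded without computing a Jensen-Shannon divergence.\<close>

lemma SUP_gan_value_ge:
  assumes "prob_space \<mu>" and "prob_space \<nu>"
  shows "ereal (- 2 * ln 2) \<le> (SUP D\<in>discriminators S. gan_value \<mu> \<nu> D)"
  using SUP_upper[OF const_discriminator, of "gan_value \<mu> \<nu>" S] gan_value_half[OF assms] by simp

lemma SUP_gan_value_same:
  assumes "prob_space \<mu>" and "sets \<mu> = sets S"
  shows "(SUP D\<in>discriminators S. gan_value \<mu> \<mu> D) = ereal (- 2 * ln 2)"
  by (intro antisym[OF SUP_least] gan_value_same_le[OF assms] SUP_gan_value_ge assms(1))

section \<open>A generator in equilibrium in both games\<close>

theorem theorem3p2:
  fixes X :: "'x measure" and Y :: "'y measure" and Z :: "'z measure"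
    and p :: "('x \<times> 'y) measure" and pz :: "'z measure"
  assumes "standard_borel X" and "standard_borel Y" and "standard_borel Z"
    and "p \<in> space (prob_algebra (X \<Otimes>\<^sub>M Y))"
    and "pz \<in> space (prob_algebra Z)"
  shows "\<exists>pg \<in> markov_kernels (Y \<Otimes>\<^sub>M Z) X.
    ((\<exists>D \<in> discriminators (X \<Otimes>\<^sub>M Y). L_xy X Y p pz D pg = sup_L_xy X Y p pz pg) \<and>
     (\<forall>pg' \<in> markov_kernels (Y \<Otimes>\<^sub>M Z) X. sup_L_xy X Y p pz pg \<le> sup_L_xy X Y p pz pg')) \<and>
    (\<exists>pinf \<in> markov_kernels X Z.
      (\<exists>D \<in> discriminators (X \<Otimes>\<^sub>M Z). L_xz X Y Z p pz D pg pinf = sup_L_xz X Y Z p pz pg pinf) \<and>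
      (\<forall>pg' \<in> markov_kernels (Y \<Otimes>\<^sub>M Z) X. \<forall>pinf' \<in> markov_kernels X Z.
        sup_L_xz X Y Z p pz pg pinf \<le> sup_L_xz X Y Z p pz pg' pinf'))"
proof -
  note p = assms(4) and pz = assms(5)
  have prob_p: "prob_space p" and sets_p [measurable_cong]: "sets p = sets (X \<Otimes>\<^sub>M Y)"
    using p by (simp_all add: space_prob_algebra)
  have sets_pz [measurable_cong]: "sets pz = sets Z" and "prob_space pz"
    using pz by (simp_all add: space_prob_algebra)
  interpret pz: prob_space pz by fact
  have mx: "marginal_x X p \<in> space (prob_algebra X)"
    unfolding marginal_x_def space_prob_algebra using prob_p
    by (simp add: prob_space.prob_space_distr)
  then have sets_mx [measurable_cong]: "sets (marginal_x X p) = sets X"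
      and "prob_space (marginal_x X p)"
    by (simp_all add: space_prob_algebra)
  interpret mx: prob_space "marginal_x X p" by fact
  have my: "marginal_y Y p \<in> space (prob_algebra Y)" by (rule marginal_y_in_prob_algebra[OF p])
  have L_xy: "L_xy X Y p pz D pg = gan_value p (generated_xy X Y p pz pg) D" for D pg
    by (simp add: L_xy_def gan_value_def)
  have L_xz: "L_xz X Y Z p pz D pg pinf =
      gan_value (inference_xz X Z p pinf) (generated_xz X Y Z p pz pg) D" for D pg pinf
    by (simp add: L_xz_def gan_value_def)
  have gen_xy: "prob_space (generated_xy X Y p pz pg)"
    if [measurable]: "pg \<in> markov_kernels (Y \<Otimes>\<^sub>M Z) X" for pg
    unfolding generated_xy_def by (rule prob_space_bind'[OF my]) (use pz in measurable)
  have gen_xz: "prob_space (generated_xz X Y Z p pz pg)"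
    if [measurable]: "pg \<in> markov_kernels (Y \<Otimes>\<^sub>M Z) X" for pg
    unfolding generated_xz_def by (rule prob_space_bind'[OF my]) (use pz in measurable)
  have inf_mem: "(\<lambda>x. pinf x \<bind> (\<lambda>z. return (X \<Otimes>\<^sub>M Z) (x, z))) \<in> X \<rightarrow>\<^sub>M prob_algebra (X \<Otimes>\<^sub>M Z)"
    if [measurable]: "pinf \<in> markov_kernels X Z" for pinf
    by measurable
  have inf_xz: "prob_space (inference_xz X Z p pinf)"
      "sets (inference_xz X Z p pinf) = sets (X \<Otimes>\<^sub>M Z)"
    if "pinf \<in> markov_kernels X Z" for pinf
    unfolding inference_xz_def using prob_space_bind'[OF mx inf_mem[OF that]]
      sets_bind'[OF mx inf_mem[OF that]] by simp_all
  obtain \<kappa> where \<kappa> [measurable]: "\<kappa> \<in> markov_kernels Y X"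
    and rect: "\<And>A B. A \<in> sets X \<Longrightarrow> B \<in> sets Y \<Longrightarrow>
      (\<integral>\<^sup>+ y\<in>B. emeasure (\<kappa> y) A \<partial>marginal_y Y p) = emeasure p (A \<times> B)"
    using regular_conditional_distribution[OF assms(1) p] by metis
  define pg where "pg = (\<lambda>(y :: 'y, z :: 'z). \<kappa> y)"
  have pg: "pg \<in> markov_kernels (Y \<Otimes>\<^sub>M Z) X" unfolding pg_def by measurable
  have ky: "sets (\<kappa> y) = sets X" "prob_space (\<kappa> y)" if "y \<in> space Y" for y
    using measurable_space[OF \<kappa> that] by (simp_all add: space_prob_algebra)
  have space_my: "space (marginal_y Y p) = space Y" by (simp add: marginal_y_def)
  \<comment> \<open>Averaging over \<open>z\<close> changes nothing, as \<open>pg\<close> ignores it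
    and \<open>pz\<close> has mass one.\<close>
  have "induced_given_y pz pg y = \<kappa> y" if "y \<in> space Y" for y
    unfolding induced_given_y_def pg_def
    using ky[OF that] by (simp add: bind_const' prob_space_imp_subprob_space pz.prob_space_axioms)
  then have gen_xy_eq: "generated_xy X Y p pz pg = p"
    unfolding generated_xy_eq_induced[OF p pz pg]
    by (subst joint_eq_disintegration[OF p \<kappa> rect, symmetric])
       (auto simp: space_my intro!: bind_cong)
  \<comment> \<open>The generated \<open>x\<close> and \<open>z\<close> are independent, so the
    posterior of \<open>z\<close> given \<open>x\<close> is the prior.\<close>
  define pinf :: "'x \<Rightarrow> 'z measure" where "pinf = (\<lambda>_. pz)"
  have pinf: "pinf \<in> markov_kernels X Z" unfolding pinf_def using pz by simp
  have "induced_given_z Y p pg z = marginal_x X p" for z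
    unfolding induced_given_z_def pg_def prod.case
    by (rule marginal_x_eq_disintegration[OF p \<kappa> rect])
  then have "generated_xz X Y Z p pz pg =
      pz \<bind> (\<lambda>z. marginal_x X p \<bind> (\<lambda>x. return (X \<Otimes>\<^sub>M Z) (x, z)))"
    by (simp only: generated_xz_eq_induced[OF p pz pg])
  \<comment> \<open>Both laws draw \<open>x\<close> and \<open>z\<close> independently and differ
    only in the order of sampling, which Fubini lets one exchange.\<close>
  also have "\<dots> = inference_xz X Z p pinf"
  proof -
    interpret pair_prob_space "marginal_x X p" pz ..
    show ?thesis unfolding inference_xz_def pinf_def
      by (rule bind_rotate[where N = "X \<Otimes>\<^sub>M Z", symmetric]) measurable
  qed
  finally have gen_xz_eq: "generated_xz X Y Z p pz pg = inference_xz X Z p pinf" .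
  note sup_xy = SUP_gan_value_same[OF prob_p sets_p]
  note sup_xz = SUP_gan_value_same[OF inf_xz[OF pinf]]
  show ?thesis
  proof (intro bexI[OF _ pg] conjI bexI[OF _ pinf] ballI)
    \<comment> \<open>The supremum is reached by the constant 1/2, so at the equilibrium it is a
      true maximum.\<close>
    show "\<exists>D \<in> discriminators (X \<Otimes>\<^sub>M Y). L_xy X Y p pz D pg = sup_L_xy X Y p pz pg"
      unfolding sup_L_xy_def L_xy gen_xy_eq sup_xy
      using gan_value_half[OF prob_p prob_p] by (intro bexI[OF _ const_discriminator])
    show "\<exists>D \<in> discriminators (X \<Otimes>\<^sub>M Z). L_xz X Y Z p pz D pg pinf = sup_L_xz X Y Z p pz pg pinf"
      unfolding sup_L_xz_def L_xz gen_xz_eq sup_xz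
      using gan_value_half inf_xz(1)[OF pinf] by (intro bexI[OF _ const_discriminator])
  next
    fix pg' assume pg': "pg' \<in> markov_kernels (Y \<Otimes>\<^sub>M Z) X"
    show "sup_L_xy X Y p pz pg \<le> sup_L_xy X Y p pz pg'"
      unfolding sup_L_xy_def L_xy gen_xy_eq sup_xy
      by (rule SUP_gan_value_ge[OF prob_p gen_xy[OF pg']])
    fix pinf' assume pinf': "pinf' \<in> markov_kernels X Z"
    show "sup_L_xz X Y Z p pz pg pinf \<le> sup_L_xz X Y Z p pz pg' pinf'"
      unfolding sup_L_xz_def L_xz gen_xz_eq sup_xz
      by (rule SUP_gan_value_ge[OF inf_xz(1)[OF pinf'] gen_xz[OF pg']])
  qed
qed

end
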